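(* Let $(M,N)$ be a pair of nonempty, closed, convex subsets of a smooth and strictly convex real Banach space $B$. Suppose that $M$ is $\phi$-approximatively compact with respect to $N$. Let $(u_n)$ be a sequence in $M$ and $v\in N$ be such that $\lim_{n\to\infty}\phi(u_n,v)=\mathrm{dist}_\phi(M,N)$. Then $(u_n)$ converges in norm to $\Pi_M(v)$.
   Context: $J:B\to B^*$ is the (single-valued) normalized duality mapping: $\langle u,Ju\rangle=\|u\|^2=\|Ju\|^2$. Define $\phi(u,v)=\|u\|^2-2\langle u,Jv\rangle+\|v\|^2$ and $\mathrm{dist}_\phi(M,N)=\inf\{\phi(u,v):u\in M,v\in N\}$. $\Pi_M(v)$ (generalized projection of $v$ onto $M$) denotes the unique element of $M$ with $\phi(\Pi_M(v),v)=\inf_{w\in M}\phi(w,v)$. $M$ is $\phi$-approximatively compact with respect to $N$ if every sequence $\{x_n\}$ in $M$ for which there is some $y\in N$ with $\phi(x_n,y)\to\inf_{w\in M}\phi(w,y)$ has a subsequence converging in norm to an element of $M$. *)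

theory Defs
  imports "HOL-Analysis.Analysis"
begin

text \<open>
  Smoothness and strict convexity are properties of the norm of the whole space, hence of the
  type, and so take a type argument.
  Smoothness is Gateaux differentiability of the norm on the unit sphere.
\<close>

definition smooth_space :: "'a::real_normed_vector itself \<Rightarrow> bool" where
  "smooth_space _ \<longleftrightarrow>
     (\<forall>x y :: 'a. norm x = 1 \<longrightarrow> norm y = 1 \<longrightarrow>
        (\<exists>L::real. ((\<lambda>t. (norm (x + t *\<^sub>R y) - norm x) / t) \<longlongrightarrow> L) (at 0)))"

definition strictly_convex_space :: "'a::real_normed_vector itself \<Rightarrow> bool" where
  "strictly_convex_space _ \<longleftrightarrow>
     (\<forall>x y :: 'a. norm x = 1 \<longrightarrow> norm y = 1 \<longrightarrow> x \<noteq> y \<longrightarrow> norm ((x + y) /\<^sub>R 2) < 1)"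

definition duality_set :: "'a::real_normed_vector \<Rightarrow> ('a \<Rightarrow>\<^sub>L real) set" where
  "duality_set u = {f. blinfun_apply f u = (norm u)\<^sup>2 \<and> (norm f)\<^sup>2 = (norm u)\<^sup>2}"

text \<open>In a smooth space every \<^term>\<open>duality_set u\<close> is a singleton, so the description below is proper.\<close>

definition duality_map :: "'a::real_normed_vector \<Rightarrow> ('a \<Rightarrow>\<^sub>L real)" where
  "duality_map u = (THE f. f \<in> duality_set u)"

definition phi :: "'a::real_normed_vector \<Rightarrow> 'a \<Rightarrow> real" where
  "phi u v = (norm u)\<^sup>2 - 2 * blinfun_apply (duality_map v) u + (norm v)\<^sup>2"

text \<open>
  In a smooth space \<^term>\<open>phi u v \<ge> (norm u - norm v)\<^sup>2\<close>, so the real infima below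
  are taken over sets bounded below.
\<close>

definition dist_phi :: "'a::real_normed_vector set \<Rightarrow> 'a set \<Rightarrow> real" where
  "dist_phi M N = Inf {phi u v | u v. u \<in> M \<and> v \<in> N}"

definition is_gen_proj :: "'a::real_normed_vector set \<Rightarrow> 'a \<Rightarrow> 'a \<Rightarrow> bool" where
  "is_gen_proj M v p \<longleftrightarrow> p \<in> M \<and> phi p v = (INF w\<in>M. phi w v)"

definition gen_proj :: "'a::real_normed_vector set \<Rightarrow> 'a \<Rightarrow> 'a" where
  "gen_proj M v = (THE p. is_gen_proj M v p)"

definition phi_approx_compact :: "'a::real_normed_vector set \<Rightarrow> 'a set \<Rightarrow> bool" where
  "phi_approx_compact M N \<longleftrightarrow>
     (\<forall>x :: nat \<Rightarrow> 'a. (\<forall>n. x n \<in> M) \<longrightarrow>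
        (\<exists>y\<in>N. (\<lambda>n. phi (x n) y) \<longlonglongrightarrow> (INF w\<in>M. phi w y)) \<longrightarrow>
        (\<exists>l\<in>M. \<exists>r. strict_mono r \<and> (x \<circ> r) \<longlonglongrightarrow> l))"

end

theory Submission
  imports Defs
begin

text \<open>
  In a smooth space the directional derivative of the norm at a unit vector is two-sided and
  sublinear, hence linear; a multiple of it is the unique element of the duality set. So the
  duality map is proper without any appeal to Hahn--Banach, and \<open>phi w v\<close> is bounded below by
  \<open>(norm w - norm v)\<^sup>2\<close>. Boundedness below gives \<open>dist_phi M N \<le> (INF w\<in>M. phi w v) \<le> phi (u n) v\<close>,
  so \<open>u\<close> and all its subsequences minimise \<open>phi _ v\<close> over \<open>M\<close>. Each subsequence thus has a further
  subsequence converging to a minimiser, and strict convexity makes the minimiser unique.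
\<close>

section \<open>Smoothness and the duality map\<close>

lemma smooth_space_directional_derivative:
  fixes x y :: "'a::real_normed_vector"
  assumes "smooth_space TYPE('a)" and "norm x = 1"
  shows "\<exists>L. ((\<lambda>t. (norm (x + t *\<^sub>R y) - norm x) / t) \<longlongrightarrow> L) (at 0)"
proof (cases "y = 0")
  case True
  then show ?thesis by (auto intro!: exI[of _ 0])
next
  case False
  define c where "c = norm y"
  define e where "e = y /\<^sub>R c"
  have c: "c > 0" and e: "norm e = 1" "y = c *\<^sub>R e"
    using False by (auto simp: c_def e_def)
  obtain L where L: "((\<lambda>t. (norm (x + t *\<^sub>R e) - norm x) / t) \<longlongrightarrow> L) (at 0)"
    using assms e by (auto simp: smooth_space_def)
  \<comment> \<open>The quotient in direction \<open>y\<close> at \<open>t\<close> is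
    \<open>c\<close> times the quotient in direction \<open>e\<close> at \<open>t * c\<close>, so
    the limit follows by substitution.\<close>
  have "filterlim (\<lambda>t. t * c) (at 0) (at (0::real))"
    using c by (auto simp: filterlim_at eventually_at_filter intro!: tendsto_eq_intros)
  from tendsto_mult[OF tendsto_const[of c] filterlim_compose[OF L this]]
  have "((\<lambda>t. c * ((norm (x + (t * c) *\<^sub>R e) - norm x) / (t * c))) \<longlongrightarrow> c * L) (at 0)" .
  moreover have "(\<lambda>t. c * ((norm (x + (t * c) *\<^sub>R e) - norm x) / (t * c)))
      = (\<lambda>t. (norm (x + t *\<^sub>R y) - norm x) / t)"
    using c by (auto simp: e(2))
  ultimately show ?thesis by auto
qed

text \<open>The two-sided limit is homogeneous for negative scalars as well, and convexity of the
  norm makes it subadditive. Being odd and subadditive it is additive, and the triangle inequality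
  bounds it by \<open>norm y\<close>.\<close>

lemma smooth_space_blinfun_derivative:
  fixes x :: "'a::real_normed_vector"
  assumes "smooth_space TYPE('a)" and x: "norm x = 1"
  obtains D :: "'a \<Rightarrow>\<^sub>L real" where
    "\<And>y. ((\<lambda>t. (norm (x + t *\<^sub>R y) - norm x) / t) \<longlongrightarrow> blinfun_apply D y) (at 0)"
proof -
  define q where "q y t = (norm (x + t *\<^sub>R y) - norm x) / t" for y t
  obtain d where d: "\<And>y. (q y \<longlongrightarrow> d y) (at 0)"
    using smooth_space_directional_derivative[OF assms] unfolding q_def by metis
  have uniq: "L = d y" if "(q y \<longlongrightarrow> L) (at 0)" for L y
    using tendsto_unique[OF _ that d] by simp
  have scale: "d (c *\<^sub>R y) = c * d y" for c y
  proof (cases "c = 0")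
    case True
    have "q 0 = (\<lambda>t. 0)" by (auto simp: q_def)
    then have "d 0 = 0" using uniq[of 0 0] by simp
    then show ?thesis using True by simp
  next
    case False
    have "filterlim (\<lambda>t. t * c) (at 0) (at (0::real))"
      using False by (auto simp: filterlim_at eventually_at_filter intro!: tendsto_eq_intros)
    from tendsto_mult[OF tendsto_const[of c] filterlim_compose[OF d[of y] this]]
    have "((\<lambda>t. c * q y (t * c)) \<longlongrightarrow> c * d y) (at 0)" .
    moreover have "(\<lambda>t. c * q y (t * c)) = q (c *\<^sub>R y)"
      using False by (auto simp: q_def)
    ultimately show ?thesis using uniq by metis
  qed
  \<comment> \<open>Estimates divided by \<open>t\<close> keep their direction only for
    \<open>t > 0\<close>, so they are passed to the limit from the right.\<close>
  have right: "(q y \<longlongrightarrow> d y) (at_right 0)" for y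
    using d by (rule tendsto_mono[rotated]) (simp add: at_le)
  have subadd: "d (y + z) \<le> d y + d z" for y z
  proof (rule tendsto_le[OF _ _ right])
    have "filterlim (\<lambda>t. t * 2) (at_right 0) (at_right (0::real))"
      by (auto simp: filterlim_at eventually_at_filter intro!: tendsto_eq_intros)
    then show "((\<lambda>t. q y (t * 2) + q z (t * 2)) \<longlongrightarrow> d y + d z) (at_right 0)"
      by (intro tendsto_add filterlim_compose[OF right])
    \<comment> \<open>Doubling the step splits twice \<open>x + t *\<^sub>R (y + z)\<close> into one
      perturbation of \<open>x\<close> along \<open>y\<close> and one along
      \<open>z\<close>.\<close>
    have "q (y + z) t \<le> q y (t * 2) + q z (t * 2)" if "t > 0" for t
    proof -
      have "2 *\<^sub>R (x + t *\<^sub>R (y + z)) = (x + (t * 2) *\<^sub>R y) + (x + (t * 2) *\<^sub>R z)"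
        by (simp add: algebra_simps scaleR_2)
      then have "2 * norm (x + t *\<^sub>R (y + z)) \<le> norm (x + (t * 2) *\<^sub>R y) + norm (x + (t * 2) *\<^sub>R z)"
        by (metis norm_triangle_ineq norm_scaleR abs_numeral)
      then have "(2 * norm (x + t *\<^sub>R (y + z)) - 2 * norm x) / (t * 2)
          \<le> (norm (x + (t * 2) *\<^sub>R y) + norm (x + (t * 2) *\<^sub>R z) - 2 * norm x) / (t * 2)"
        using that by (intro divide_right_mono) auto
      then show ?thesis
        by (simp add: q_def add_divide_distrib diff_divide_distrib)
    qed
    then show "\<forall>\<^sub>F t in at_right 0. q (y + z) t \<le> q y (t * 2) + q z (t * 2)"
      by (auto simp: eventually_at_filter)
  qed simp
  have neg: "d (- y) = - d y" for y
    using scale[of "-1" y] by simp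
  have "d (y + z) = d y + d z" for y z
    using subadd[of y z] subadd[of "- y" "- z"] neg[of "y + z"] neg[of y] neg[of z] by simp
  moreover have "norm (d y) \<le> norm y * 1" for y
  proof -
    have "q y t \<le> norm y" if "t > 0" for y t
      using norm_triangle_ineq[of x "t *\<^sub>R y"] that by (simp add: q_def field_simps)
    then have "d y \<le> norm y" for y
      by (intro tendsto_upperbound[OF right]) (auto simp: eventually_at_filter)
    from this[of y] this[of "- y"] show ?thesis by (simp add: neg)
  qed
  ultimately have "bounded_linear d"
    using scale by (intro bounded_linear_intro[where K = 1]) auto
  then show ?thesis
    using that[of "Blinfun d"] d by (simp add: bounded_linear_Blinfun_apply q_def[abs_def])
qed

lemma duality_set_zero: "duality_set 0 = {0}"
  by (auto simp: duality_set_def)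

text \<open>The derivative \<open>D\<close> of the norm at the normalised vector \<open>x\<close>,
  scaled by \<open>r = norm v\<close>, gives existence. Any other candidate \<open>f\<close> is
  dominated by \<open>r * norm\<close> with equality at \<open>x\<close>; comparing directional
  derivatives puts \<open>f\<close> below \<open>r *\<^sub>R D\<close>, and linearity forces
  equality.\<close>

lemma duality_set_singleton:
  fixes v :: "'a::real_normed_vector"
  assumes smooth: "smooth_space TYPE('a)"
  shows "\<exists>!f. f \<in> duality_set v"
proof (cases "v = 0")
  case True
  then show ?thesis by (simp add: duality_set_zero)
next
  case False
  define r where "r = norm v"
  define x where "x = v /\<^sub>R r"
  have r: "r > 0" and x: "norm x = 1" "v = r *\<^sub>R x"
    using False by (auto simp: r_def x_def)
  obtain D :: "'a \<Rightarrow>\<^sub>L real" where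
    D: "\<And>y. ((\<lambda>t. (norm (x + t *\<^sub>R y) - norm x) / t) \<longlongrightarrow> blinfun_apply D y) (at 0)"
    using smooth_space_blinfun_derivative[OF smooth x(1)] by blast
  have right: "((\<lambda>t. (norm (x + t *\<^sub>R y) - norm x) / t) \<longlongrightarrow> blinfun_apply D y) (at_right 0)" for y
    using D by (rule tendsto_mono[rotated]) (simp add: at_le)
  have Dx: "blinfun_apply D x = 1"
  proof (rule tendsto_unique[OF _ right])
    have "(norm (x + t *\<^sub>R x) - norm x) / t = 1" if "t > 0" for t
    proof -
      have "x + t *\<^sub>R x = (1 + t) *\<^sub>R x" by (simp add: algebra_simps)
      then show ?thesis using that x(1) by simp
    qed
    then show "((\<lambda>t. (norm (x + t *\<^sub>R x) - norm x) / t) \<longlongrightarrow> 1) (at_right 0)"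
      by (intro tendsto_eventually) (auto simp: eventually_at_filter)
  qed simp
  have D_le: "blinfun_apply D y \<le> norm y" for y
  proof (rule tendsto_upperbound[OF right])
    have "(norm (x + t *\<^sub>R y) - norm x) / t \<le> norm y" if "t > 0" for t
      using norm_triangle_ineq[of x "t *\<^sub>R y"] that by (simp add: field_simps)
    then show "\<forall>\<^sub>F t in at_right 0. (norm (x + t *\<^sub>R y) - norm x) / t \<le> norm y"
      by (auto simp: eventually_at_filter)
  qed simp
  have "norm D \<le> 1"
  proof (rule norm_blinfun_bound)
    show "norm (blinfun_apply D y) \<le> 1 * norm y" for y
      using D_le[of y] D_le[of "- y"] by (simp add: blinfun.minus_right)
  qed simp
  moreover have "1 \<le> norm D"
    using norm_blinfun[of D x] Dx x(1) by simp
  ultimately have "r *\<^sub>R D \<in> duality_set v"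
    using Dx r by (simp add: duality_set_def x blinfun.scaleR_left blinfun.scaleR_right
        power2_eq_square)
  moreover have "f = r *\<^sub>R D" if "f \<in> duality_set v" for f
  proof -
    have fv: "blinfun_apply f v = r\<^sup>2" and nf: "norm f = r"
      using that r by (auto simp: duality_set_def r_def[symmetric] power2_eq_iff_nonneg)
    have fx: "blinfun_apply f x = r"
      using fv r by (simp add: x blinfun.scaleR_right power2_eq_square)
    have le: "blinfun_apply f y \<le> r * blinfun_apply D y" for y
    proof (rule tendsto_lowerbound[OF tendsto_mult[OF tendsto_const right]])
      have "blinfun_apply f y \<le> r * ((norm (x + t *\<^sub>R y) - norm x) / t)" if "t > 0" for t
      proof -
        \<comment> \<open>Both sides equal \<open>r\<close> at \<open>t = 0\<close>; subtracting
          this and dividing by \<open>t\<close> produces the difference quotient.\<close>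
        have "blinfun_apply f (x + t *\<^sub>R y) \<le> r * norm (x + t *\<^sub>R y)"
          using norm_blinfun[of f "x + t *\<^sub>R y"] by (simp add: nf)
        then show ?thesis
          using that fx x(1) by (simp add: blinfun.add_right blinfun.scaleR_right field_simps)
      qed
      then show "\<forall>\<^sub>F t in at_right 0. blinfun_apply f y \<le> r * ((norm (x + t *\<^sub>R y) - norm x) / t)"
        by (auto simp: eventually_at_filter)
    qed simp
    show ?thesis
    proof (rule blinfun_eqI)
      show "blinfun_apply f y = blinfun_apply (r *\<^sub>R D) y" for y
        using le[of y] le[of "- y"] by (simp add: blinfun.minus_right blinfun.scaleR_left)
    qed
  qed
  ultimately show ?thesis by blast
qed

lemma norm_duality_map:
  fixes v :: "'a::real_normed_vector"
  assumes "smooth_space TYPE('a)"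
  shows "norm (duality_map v) = norm v"
proof -
  have "duality_map v \<in> duality_set v"
    unfolding duality_map_def by (rule theI'[OF duality_set_singleton[OF assms]])
  then show ?thesis by (simp add: duality_set_def)
qed

section \<open>Bounds on \<open>phi\<close> and comparison of the infima\<close>

text \<open>Bounding the pairing by \<open>norm (duality_map v) * norm u\<close>, which is
  \<open>norm v * norm u\<close>, leaves a perfect square.\<close>

lemma phi_lower_bound:
  fixes u v :: "'a::real_normed_vector"
  assumes "smooth_space TYPE('a)"
  shows "(norm u - norm v)\<^sup>2 \<le> phi u v"
  using norm_blinfun[of "duality_map v" u] norm_duality_map[OF assms, of v]
  by (simp add: phi_def power2_diff mult.commute)

lemma phi_nonneg:
  fixes u v :: "'a::real_normed_vector"
  assumes "smooth_space TYPE('a)"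
  shows "0 \<le> phi u v"
  using phi_lower_bound[OF assms, of u v] by (meson order_trans zero_le_power2)

lemma bdd_below_phi:
  fixes v :: "'a::real_normed_vector"
  assumes "smooth_space TYPE('a)"
  shows "bdd_below ((\<lambda>w. phi w v) ` M)"
  using phi_nonneg[OF assms] by (auto intro!: bdd_belowI2)

text \<open>Fixing \<open>v\<close> restricts the pairs over which \<open>dist_phi\<close> is taken;
  nonnegativity of \<open>phi\<close> makes the real infimum a genuine lower bound.\<close>

lemma dist_phi_le_INF:
  fixes v :: "'a::real_normed_vector"
  assumes "smooth_space TYPE('a)" "M \<noteq> {}" "v \<in> N"
  shows "dist_phi M N \<le> (INF w\<in>M. phi w v)"
proof (rule cINF_greatest)
  fix w assume "w \<in> M"
  moreover have "bdd_below {phi u v |u v. u \<in> M \<and> v \<in> N}"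
    using phi_nonneg[OF assms(1)] by (auto intro!: bdd_belowI[of _ 0])
  ultimately show "dist_phi M N \<le> phi w v"
    unfolding dist_phi_def using assms(3) by (intro cInf_lower) auto
qed (use assms in auto)

lemma tendsto_phi:
  assumes "(f \<longlongrightarrow> l) F"
  shows "((\<lambda>n. phi (f n) v) \<longlongrightarrow> phi l v) F"
  unfolding phi_def by (intro tendsto_intros assms)

section \<open>Strict convexity and uniqueness of the projection\<close>

lemma strictly_convex_norm_midpoint:
  fixes p q :: "'a::real_normed_vector"
  assumes "strictly_convex_space TYPE('a)" and "norm p = norm q" and "p \<noteq> q"
  shows "norm ((p + q) /\<^sub>R 2) < norm p"
proof -
  define r where "r = norm p"
  have r: "r > 0" using assms(2,3) by (auto simp: r_def)
  have "norm ((p /\<^sub>R r + q /\<^sub>R r) /\<^sub>R 2) < 1"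
  proof -
    have "norm (p /\<^sub>R r) = 1" "norm (q /\<^sub>R r) = 1" "p /\<^sub>R r \<noteq> q /\<^sub>R r"
      using r assms(2,3) by (auto simp: r_def)
    then show ?thesis
      using assms(1) unfolding strictly_convex_space_def by blast
  qed
  also have "(p /\<^sub>R r + q /\<^sub>R r) /\<^sub>R 2 = ((p + q) /\<^sub>R 2) /\<^sub>R r"
    by (simp add: algebra_simps)
  finally have "norm ((p + q) /\<^sub>R 2) / r < 1"
    using r by (simp only: norm_scaleR) (simp add: field_simps)
  then show ?thesis using r by (simp only: divide_less_eq_1_pos r_def)
qed

text \<open>For equal norms the strictness comes from the space; for different norms it comes from
  the square function on the reals.\<close>

lemma strictly_convex_norm_square_midpoint:
  fixes p q :: "'a::real_normed_vector"
  assumes "strictly_convex_space TYPE('a)" and "p \<noteq> q"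
  shows "(norm ((p + q) /\<^sub>R 2))\<^sup>2 < ((norm p)\<^sup>2 + (norm q)\<^sup>2) / 2"
proof (cases "norm p = norm q")
  case True
  then show ?thesis
    using power_strict_mono[OF strictly_convex_norm_midpoint[OF assms(1) True assms(2)]] by simp
next
  case False
  have "norm ((p + q) /\<^sub>R 2) \<le> (norm p + norm q) / 2"
    using norm_triangle_ineq[of p q] by simp
  then have "(norm ((p + q) /\<^sub>R 2))\<^sup>2 \<le> ((norm p + norm q) / 2)\<^sup>2"
    by (intro power_mono) auto
  \<comment> \<open>The mean of the squares exceeds the square of the mean by a quarter of this
    quantity.\<close>
  moreover have "(norm p - norm q)\<^sup>2 > 0" using False by simp
  ultimately show ?thesis by (simp add: power2_eq_square field_simps)
qed

text \<open>Apart from the squared norm, \<open>phi\<close> is affine in its first argument, so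
  those terms agree at the midpoint.\<close>

lemma phi_midpoint_less:
  fixes p q v :: "'a::real_normed_vector"
  assumes "strictly_convex_space TYPE('a)" and "p \<noteq> q"
  shows "phi ((p + q) /\<^sub>R 2) v < (phi p v + phi q v) / 2"
  using strictly_convex_norm_square_midpoint[OF assms]
  by (simp add: phi_def blinfun.add_right blinfun.scaleR_right field_simps)

text \<open>The midpoint of two distinct minimisers would lie in \<open>M\<close> with a value below
  the infimum.\<close>

lemma is_gen_proj_unique:
  fixes M :: "'a::real_normed_vector set"
  assumes "smooth_space TYPE('a)" and "strictly_convex_space TYPE('a)" and "convex M"
    and p: "is_gen_proj M v p" and q: "is_gen_proj M v q"
  shows "p = q"
proof (rule ccontr)
  assume "p \<noteq> q"
  have "(1 / 2) *\<^sub>R p + (1 / 2) *\<^sub>R q \<in> M"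
    using assms(3) p q by (intro convexD) (auto simp: is_gen_proj_def)
  then have "(p + q) /\<^sub>R 2 \<in> M" by (simp add: scaleR_add_right inverse_eq_divide)
  then have "(INF w\<in>M. phi w v) \<le> phi ((p + q) /\<^sub>R 2) v"
    by (rule cINF_lower[OF bdd_below_phi[OF assms(1)]])
  then show False
    using phi_midpoint_less[OF assms(2) \<open>p \<noteq> q\<close>, of v] p q by (simp add: is_gen_proj_def)
qed

section \<open>Subsequences and convergence\<close>

text \<open>If convergence failed, some open neighbourhood of \<open>p\<close> would be avoided by a
  whole subsequence, none of whose subsequences could tend to \<open>p\<close>.\<close>

lemma LIMSEQ_if_subseq_subseq:
  fixes u :: "nat \<Rightarrow> 'a::topological_space"
  assumes "\<And>r :: nat \<Rightarrow> nat. strict_mono r \<Longrightarrow> \<exists>s. strict_mono s \<and> (u \<circ> r \<circ> s) \<longlonglongrightarrow> p"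
  shows "u \<longlonglongrightarrow> p"
proof (rule topological_tendstoI, rule ccontr)
  fix S assume S: "open S" "p \<in> S" and "\<not> (\<forall>\<^sub>F n in sequentially. u n \<in> S)"
  then have "\<exists>\<^sub>F n in cofinite. u n \<notin> S"
    by (simp only: cofinite_eq_sequentially not_eventually)
  then have "infinite {n. u n \<notin> S}" by (rule frequently_cofinite[THEN iffD1])
  from infinite_enumerate[OF this]
  obtain r :: "nat \<Rightarrow> nat" where r: "strict_mono r" "\<And>n. u (r n) \<notin> S"
    by auto
  then obtain s where "(u \<circ> r \<circ> s) \<longlonglongrightarrow> p" using assms by blast
  then have "\<forall>\<^sub>F n in sequentially. (u \<circ> r \<circ> s) n \<in> S"
    using S by (rule topological_tendstoD)
  with r show False by simp
qed

text \<open>Continuity of \<open>phi\<close> in its first argument makes the limit supplied by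
  approximative compactness attain the infimum. Existence of the generalized projection comes from
  here.\<close>

lemma phi_minimizing_subseq_is_gen_proj:
  assumes "phi_approx_compact M N" and "v \<in> N" and "\<And>n. x n \<in> M"
    and lim: "(\<lambda>n. phi (x n) v) \<longlonglongrightarrow> (INF w\<in>M. phi w v)"
  obtains l r where "is_gen_proj M v l" "strict_mono r" "(x \<circ> r) \<longlonglongrightarrow> l"
proof -
  obtain l r where l: "l \<in> M" "strict_mono r" "(x \<circ> r) \<longlonglongrightarrow> l"
    using assms unfolding phi_approx_compact_def by blast
  have "(\<lambda>n. phi ((x \<circ> r) n) v) \<longlonglongrightarrow> (INF w\<in>M. phi w v)"
    using LIMSEQ_subseq_LIMSEQ[OF lim l(2)] by (simp add: o_def)
  then have "is_gen_proj M v l"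
    using LIMSEQ_unique[OF tendsto_phi[OF l(3)]] l(1) by (simp add: is_gen_proj_def)
  with l that show ?thesis by blast
qed

theorem proposition2p14:
  fixes M N :: "'a::banach set" and u :: "nat \<Rightarrow> 'a" and v :: 'a
  assumes "smooth_space TYPE('a)" and "strictly_convex_space TYPE('a)"
    and "M \<noteq> {}" and "closed M" and "convex M"
    and "N \<noteq> {}" and "closed N" and "convex N"
    and "phi_approx_compact M N"
    and "\<And>n. u n \<in> M" and "v \<in> N"
    and "(\<lambda>n. phi (u n) v) \<longlonglongrightarrow> dist_phi M N"
  shows "(\<exists>!p. is_gen_proj M v p) \<and> u \<longlonglongrightarrow> gen_proj M v"
proof -
  \<comment> \<open>Passing to the limit squeezes the infimum for this \<open>v\<close> between
    \<open>dist_phi M N\<close> and itself, which turns \<open>u\<close> into a minimising sequence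
    for \<open>v\<close>.\<close>
  have "(INF w\<in>M. phi w v) \<le> phi (u n) v" for n
    by (rule cINF_lower[OF bdd_below_phi[OF assms(1)] assms(10)])
  then have "(INF w\<in>M. phi w v) \<le> dist_phi M N"
    by (intro LIMSEQ_le_const[OF assms(12)] exI allI impI)
  then have "dist_phi M N = (INF w\<in>M. phi w v)"
    by (rule antisym[OF dist_phi_le_INF[OF assms(1,3,11)]])
  then have lim: "(\<lambda>n. phi (u n) v) \<longlonglongrightarrow> (INF w\<in>M. phi w v)"
    using assms(12) by (simp only:)
  obtain p where p: "is_gen_proj M v p"
    using phi_minimizing_subseq_is_gen_proj[OF assms(9,11,10) lim] by blast
  have unique: "q = p" if "is_gen_proj M v q" for q
    using is_gen_proj_unique[OF assms(1,2,5) that p] .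
  have "u \<longlonglongrightarrow> p"
  proof (rule LIMSEQ_if_subseq_subseq)
    fix r :: "nat \<Rightarrow> nat" assume "strict_mono r"
    then have "(\<lambda>n. phi ((u \<circ> r) n) v) \<longlonglongrightarrow> (INF w\<in>M. phi w v)"
      using LIMSEQ_subseq_LIMSEQ[OF lim] by (simp add: o_def)
    moreover have "(u \<circ> r) n \<in> M" for n using assms(10) by simp
    ultimately obtain l s where "is_gen_proj M v l" "strict_mono s" "(u \<circ> r \<circ> s) \<longlonglongrightarrow> l"
      using phi_minimizing_subseq_is_gen_proj[OF assms(9,11)] by blast
    then show "\<exists>s. strict_mono s \<and> (u \<circ> r \<circ> s) \<longlonglongrightarrow> p" using unique by blast
  qed
  moreover have "gen_proj M v = p"
    unfolding gen_proj_def using p unique by (rule the_equality)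
  ultimately show ?thesis using p unique by (metis (lifting))
qed

end
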